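(* Let $k>1$ denote the common measure of the octave intervals. For every pair of sounds $s$ and $t$, $s\simeq t$ if and only if $|[s,t]|=k^n$ for some $n\in\mathbb{Z}$.
   Context: Setting: a set $\mathbb{S}$ (of "sounds"), a binary relation $*$ on $\mathbb{S}$ ($x*y$: $x$ is lower-pitched than $y$), a relation $\cong$ on intervals and a binary relation $\simeq$ on $\mathbb{S}$ ("equitonal"), satisfying the axioms below. (The paper's further axioms on loudness and colour concern other notions not occurring in the claim.) Pitch. Write $x\sim y$ iff neither $x*y$ nor $y*x$. (1) $\neg(x*x)$ for all $x$. (2) $*$ is transitive. (3) There are $x,y$ with $x*y$ or $y*x$. (4) If $x*y$, then no $z$ satisfies both $x\sim z$ and $y\sim z$. (5) For every $x$ there are $a,b$ with $a*x$ and $x*b$; and if $x*y$ there is $a$ with $x*a$ and $a*y$. Then $\sim$ is an equivalence relation; $\tilde x$ is the class of $x$. Intervals. $[a,b]:=(\tilde a,\tilde b)$, $[a,b]^{-1}:=[b,a]$, $\mathbb{I}:=(\mathbb{S}/\sim)\times(\mathbb{S}/\sim)$, and $\cong$ is a binary relation on $\mathbb{I}$. (6) $\cong$ is reflexive. (7) $\cong$ is transitive. (8) For all $x,y,a$ there is $b$ with $[x,y]\cong[a,b]$, and any $b'$ with $[x,y]\cong[a,b']$ satisfies $b\sim b'$. (9) If $a*b$: $[a,b]\cong[c,d]$ implies $c*d$; and $[a,b]\cong[c,d]$ iff $[b,a]\cong[d,c]$. (10) If $a*b$ and $b*c$: $[a,b]\cong[a',b']$ and $[b,c]\cong[b',c']$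 imply $[a,c]\cong[a',c']$; and $[a,b]\cong[a',b']^{-1}$ and $[b,c]\cong[b',c']^{-1}$ imply $[a,c]\cong[a',c']^{-1}$. (11) (Dedekind) If $\mathbb{S}$ is partitioned into two nonempty sets $P,Q$ such that no sound of $Q$ is lower-pitched than a sound of $P$, there is $\theta\in\mathbb{S}$ such that every $s*\theta$ lies in $P$ and every $s$ with $\theta*s$ lies in $Q$. Measure. Sounds $x_0*y_0$ and a real $\lambda>1$ are fixed; $|\cdot|:\mathbb{I}\to\mathbb{R}^+$ is the unique function with $|[x_0,y_0]|=\lambda$, $|[a,b]|>1$ iff $a*b$, $|[a,b]|=1$ iff $a\sim b$, $|[a,b]|<1$ iff $b*a$, $|[a,b]|=|[c,d]|$ iff $[a,b]\cong[c,d]$, and $|[a,c]|=|[a,b]|\cdot|[b,c]|$; it exists under (1)-(11) and is onto. Tonality. (15) $x\sim y$ implies $x\simeq y$; and $x\simeq z$, $y\simeq z$ imply $x\simeq y$. A sound minimal with respect to $*$ in $\{x: x\simeq s,\ s*x\}$, when it exists, is denoted $s^*$ (unique up to $\sim$), and $[s,s^*]$ is called an octave interval. Standing assumption: an octave interval exists. (16) Every interval congruent to an octave interval is an octave interval. Under these axioms all octave intervals are congruent, hence have one common measure. *)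

theory Defs
  imports Complex_Main
begin

text \<open>
  Sounds are the elements of the type \<open>'a\<close>; \<open>x \<prec> y\<close> means that \<open>x\<close> is lower-pitched than \<open>y\<close>.
\<close>

locale pitch =
  fixes lower :: "'a \<Rightarrow> 'a \<Rightarrow> bool"  (infix \<open>\<prec>\<close> 50)
begin

definition same_pitch :: "'a \<Rightarrow> 'a \<Rightarrow> bool"  (infix \<open>\<sim>\<close> 50)
  where "x \<sim> y \<longleftrightarrow> \<not> x \<prec> y \<and> \<not> y \<prec> x"

definition pitch_rel :: "('a \<times> 'a) set"
  where "pitch_rel = {(x, y). x \<sim> y}"

definition interval :: "'a \<Rightarrow> 'a \<Rightarrow> 'a set \<times> 'a set"
  where "interval a b = (pitch_rel `` {a}, pitch_rel `` {b})"

definition intervals :: "('a set \<times> 'a set) set"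
  where "intervals = (UNIV // pitch_rel) \<times> (UNIV // pitch_rel)"

end

locale pitch_space = pitch +
  assumes lower_irrefl: "\<not> x \<prec> x"
    and lower_trans: "x \<prec> y \<Longrightarrow> y \<prec> z \<Longrightarrow> x \<prec> z"
    and lower_nontrivial: "\<exists>x y. x \<prec> y \<or> y \<prec> x"
    and lower_separates: "x \<prec> y \<Longrightarrow> \<not> (\<exists>z. x \<sim> z \<and> y \<sim> z)"
    and lower_unbounded: "\<exists>a b. a \<prec> x \<and> x \<prec> b"
    and lower_dense: "x \<prec> y \<Longrightarrow> \<exists>a. x \<prec> a \<and> a \<prec> y"

text \<open>
  The congruence is a relation on the set \<open>intervals\<close>; its values on other pairs of sets of
  sounds are unconstrained and never used.  The inverse \<open>[a,b]\<^sup>-\<^sup>1 = [b,a]\<close> of an interval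
  is obtained by swapping its components.
\<close>

locale interval_space = pitch_space +
  fixes cong :: "'a set \<times> 'a set \<Rightarrow> 'a set \<times> 'a set \<Rightarrow> bool"  (infix \<open>\<cong>\<close> 50)
  assumes cong_refl: "reflp_on intervals (\<cong>)"
    and cong_trans: "transp_on intervals (\<cong>)"
    and cong_transport:
      "\<exists>b. interval x y \<cong> interval a b \<and> (\<forall>b'. interval x y \<cong> interval a b' \<longrightarrow> b \<sim> b')"
    and cong_lower: "a \<prec> b \<Longrightarrow> interval a b \<cong> interval c d \<Longrightarrow> c \<prec> d"
    and cong_inverse: "a \<prec> b \<Longrightarrow>
      interval a b \<cong> interval c d \<longleftrightarrow> interval b a \<cong> interval d c"
    and cong_add: "a \<prec> b \<Longrightarrow> b \<prec> c \<Longrightarrow>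
      interval a b \<cong> interval a' b' \<Longrightarrow> interval b c \<cong> interval b' c' \<Longrightarrow>
      interval a c \<cong> interval a' c'"
    and cong_add_inverse: "a \<prec> b \<Longrightarrow> b \<prec> c \<Longrightarrow>
      interval a b \<cong> prod.swap (interval a' b') \<Longrightarrow>
      interval b c \<cong> prod.swap (interval b' c') \<Longrightarrow>
      interval a c \<cong> prod.swap (interval a' c')"
    and dedekind: "P \<union> Q = UNIV \<Longrightarrow> P \<inter> Q = {} \<Longrightarrow> P \<noteq> {} \<Longrightarrow> Q \<noteq> {} \<Longrightarrow>
      \<forall>q\<in>Q. \<forall>p\<in>P. \<not> q \<prec> p \<Longrightarrow>
      \<exists>\<theta>. (\<forall>s. s \<prec> \<theta> \<longrightarrow> s \<in> P) \<and> (\<forall>s. \<theta> \<prec> s \<longrightarrow> s \<in> Q)"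

text \<open>
  The assumptions below determine \<open>m\<close> on \<open>intervals\<close>; elsewhere its values are irrelevant.
\<close>

locale interval_measure = interval_space +
  fixes x\<^sub>0 y\<^sub>0 :: 'a
    and lam :: real
    and m :: "'a set \<times> 'a set \<Rightarrow> real"
  assumes unit_lower: "x\<^sub>0 \<prec> y\<^sub>0"
    and lam_gt_1: "lam > 1"
    and measure_pos: "i \<in> intervals \<Longrightarrow> m i > 0"
    and measure_unit: "m (interval x\<^sub>0 y\<^sub>0) = lam"
    and measure_gt_1: "m (interval a b) > 1 \<longleftrightarrow> a \<prec> b"
    and measure_eq_1: "m (interval a b) = 1 \<longleftrightarrow> a \<sim> b"
    and measure_lt_1: "m (interval a b) < 1 \<longleftrightarrow> b \<prec> a"
    and measure_cong: "m (interval a b) = m (interval c d) \<longleftrightarrow> interval a b \<cong> interval c d"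
    and measure_mult: "m (interval a c) = m (interval a b) * m (interval b c)"

locale equitonal = pitch +
  fixes equitonal :: "'a \<Rightarrow> 'a \<Rightarrow> bool"  (infix \<open>\<simeq>\<close> 50)
begin

text \<open>\<open>is_star s t\<close> says that \<open>t\<close> is a possible choice of \<open>s\<^sup>*\<close>, which is unique only up to \<open>\<sim>\<close>.\<close>

definition is_star :: "'a \<Rightarrow> 'a \<Rightarrow> bool"
  where "is_star s t \<longleftrightarrow>
    t \<in> {x. x \<simeq> s \<and> s \<prec> x} \<and> (\<forall>y \<in> {x. x \<simeq> s \<and> s \<prec> x}. \<not> y \<prec> t)"

definition octave_interval :: "'a set \<times> 'a set \<Rightarrow> bool"
  where "octave_interval i \<longleftrightarrow> (\<exists>s t. is_star s t \<and> i = interval s t)"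

definition octave_measure :: "('a set \<times> 'a set \<Rightarrow> real) \<Rightarrow> real"
  where "octave_measure m = (THE k. \<forall>i. octave_interval i \<longrightarrow> m i = k)"

end

locale tonality = interval_measure + equitonal +
  assumes same_pitch_equitonal: "x \<sim> y \<Longrightarrow> x \<simeq> y"
    and equitonal_euclidean: "x \<simeq> z \<Longrightarrow> y \<simeq> z \<Longrightarrow> x \<simeq> y"
    and octave_exists: "\<exists>i. octave_interval i"
    and octave_cong: "octave_interval i \<Longrightarrow> j \<in> intervals \<Longrightarrow> j \<cong> i \<Longrightarrow> octave_interval j"
begin

text \<open>The description defining \<open>octave_measure\<close> is proper, and its value exceeds \<open>1\<close>.\<close>

lemma same_pitch_measure:
  assumes "a \<sim> a'" "b \<sim> b'"
  shows "m (interval a b) = m (interval a' b')"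
proof -
  have "m (interval a a') = 1" "m (interval b b') = 1" "m (interval b' b) = 1"
    using assms measure_eq_1 unfolding same_pitch_def by auto
  then show ?thesis
    using measure_mult[of a b a'] measure_mult[of a' b b'] by simp
qed

lemma interval_eqD:
  assumes "interval a b = interval c d"
  shows "a \<sim> c" "b \<sim> d"
  using assms lower_irrefl
  unfolding interval_def pitch_rel_def same_pitch_def by auto

lemma same_pitch_lower:
  assumes "a \<sim> a'" "b \<sim> b'" "a \<prec> b"
  shows "a' \<prec> b'"
  using same_pitch_measure[OF assms(1,2)] assms(3) measure_gt_1 by metis

lemma same_pitch_refl: "a \<sim> a"
  by (simp add: same_pitch_def lower_irrefl)

lemma octave_common:
  assumes "octave_interval i" "octave_interval j"
  shows "m i = m j"
proof -
  obtain s t where i: "is_star s t" "i = interval s t"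
    using assms(1) octave_interval_def by auto
  obtain u v where j: "is_star u v" "j = interval u v"
    using assms(2) octave_interval_def by auto
  obtain w where w: "interval s t \<cong> interval u w"
    using cong_transport by blast
  have mw: "m (interval s t) = m (interval u w)"
    using w measure_cong by blast
  have "interval u w \<cong> interval s t"
    using measure_cong mw by metis
  moreover have "interval u w \<in> intervals"
    by (auto simp: interval_def intervals_def quotient_def)
  ultimately have "octave_interval (interval u w)"
    using octave_cong assms(1) i(2) by blast
  then obtain u' w' where star': "is_star u' w'" and "interval u w = interval u' w'"
    using octave_interval_def by auto
  then have sim: "u \<sim> u'" "w \<sim> w'"
    using interval_eqD by blast+
  have sym: "\<And>x y. x \<sim> y \<Longrightarrow> y \<sim> x"
    by (auto simp: same_pitch_def)
  have eqsym: "\<And>x y. x \<simeq> y \<Longrightarrow> y \<simeq> x"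
    using equitonal_euclidean same_pitch_equitonal same_pitch_refl by blast
  have uu: "u \<simeq> u'" "u' \<simeq> u"
    using sim sym same_pitch_equitonal by blast+
  have eqtr: "\<And>x y z. x \<simeq> y \<Longrightarrow> y \<simeq> z \<Longrightarrow> x \<simeq> z"
    using eqsym equitonal_euclidean by blast
  have "v \<simeq> u'" "u' \<prec> v"
    using j(1) uu eqtr same_pitch_lower sim(1) same_pitch_refl unfolding is_star_def by blast+
  then have "\<not> v \<prec> w'"
    using star' unfolding is_star_def by blast
  moreover have "w' \<simeq> u" "u \<prec> w'"
    using star' uu eqtr same_pitch_lower sym sim(1) same_pitch_refl unfolding is_star_def by blast+
  then have "\<not> w' \<prec> v"
    using j(1) unfolding is_star_def by blast
  ultimately have "w' \<sim> v"
    by (auto simp: same_pitch_def)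
  then have "m (interval u w) = m (interval u v)"
    using same_pitch_measure sim(2) same_pitch_refl by metis
  then show ?thesis
    using mw i(2) j(2) by simp
qed

lemma octave_measure_eq:
  assumes "octave_interval i"
  shows "m i = octave_measure m"
  unfolding octave_measure_def
  by (rule sym, rule the_equality) (use assms octave_common in blast)+

lemma octave_measure_gt_1: "octave_measure m > 1"
proof -
  obtain s t where st: "is_star s t"
    using octave_exists octave_interval_def by auto
  then have "octave_measure m = m (interval s t)"
    using octave_measure_eq octave_interval_def by metis
  then show ?thesis
    using st measure_gt_1 unfolding is_star_def by auto
qed

end

end

theory Submission
  imports Defs
begin

text \<open>
  The octave intervals are exactly the intervals of measure \<open>k\<close>
  (\<open>is_star_iff_measure\<close>): intervals of equal measure are congruent, and an interval congruent
  to an octave interval is one.  So stepping by the factor \<open>k\<close>, upwards or downwards, never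
  leaves the equitonality class of a sound; by transport of intervals such steps are possible
  from every sound, and hence measure \<open>k\<^sup>n\<close> implies equitonality
  (\<open>equitonal_if_measure_powi\<close>).

  Conversely, given \<open>s \<simeq> t\<close>, the powers of \<open>k > 1\<close> cut the positive reals into the half-open
  pieces from \<open>k\<^sup>n\<close> to \<open>k\<^sup>n\<^sup>+\<^sup>1\<close>.  Let \<open>w\<close> be the sound obtained from \<open>s\<close> by \<open>n\<close> octave steps, where
  \<open>n\<close> is the index of the piece that contains \<open>|[s,t]|\<close>.  Then \<open>w \<simeq> t\<close> and
  \<open>1 \<le> |[w,t]| < k\<close>.  If \<open>|[w,t]|\<close> were greater than 1, then \<open>t\<close> would be a sound equitonal to
  \<open>w\<close> lying strictly between \<open>w\<close> and \<open>w\<^sup>*\<close>, against the minimality of \<open>w\<^sup>*\<close>.  So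
  \<open>|[w,t]| = 1\<close>, that is, \<open>|[s,t]| = k\<^sup>n\<close>.
\<close>

lemma powi_bracket:
  fixes k x :: real
  assumes "k > 1" "x > 0"
  shows "\<exists>n::int. k powi n \<le> x \<and> x < k * k powi n"
proof -
  define n where "n = \<lfloor>log k x\<rfloor>"
  have "k powr of_int n \<le> x" "x < k powr (of_int n + 1)"
    using assms unfolding n_def
    by (simp_all add: powr_le_iff less_powr_iff)
  then show ?thesis
    using assms by (auto simp: powr_add powr_real_of_int' mult.commute)
qed

context tonality
begin

lemma interval_in_intervals: "interval a b \<in> intervals"
  by (auto simp: interval_def intervals_def quotient_def)

lemma equitonal_refl: "x \<simeq> x"
  using same_pitch_equitonal same_pitch_refl by blast

lemma equitonal_sym: "x \<simeq> y \<Longrightarrow> y \<simeq> x"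
  using equitonal_euclidean equitonal_refl by blast

lemma equitonal_trans: "x \<simeq> y \<Longrightarrow> y \<simeq> z \<Longrightarrow> x \<simeq> z"
  using equitonal_euclidean equitonal_sym by blast

lemma measure_inverse: "m (interval b a) = inverse (m (interval a b))"
proof -
  have "m (interval b a) * m (interval a b) = 1"
    using measure_mult[of b b a] measure_eq_1 same_pitch_refl by metis
  then show ?thesis
    by (metis inverse_unique mult.commute)
qed

lemma measure_transport: "\<exists>d. m (interval c d) = m (interval a b)"
  using cong_transport measure_cong by metis

text \<open>
  An octave interval is determined only as a pair of pitch classes, so being a star has to be
  carried over to arbitrary representatives of these classes.
\<close>

lemma is_star_same_pitch:
  assumes "is_star s t" "s \<sim> s'" "t \<sim> t'"
  shows "is_star s' t'"
proof -
  have sym: "s' \<sim> s" "t' \<sim> t"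
    using assms(2,3) by (auto simp: same_pitch_def)
  have eq: "y \<simeq> s" if "y \<simeq> s'" for y
    using that sym same_pitch_equitonal equitonal_trans by blast
  have "t' \<simeq> s'"
    using assms sym same_pitch_equitonal equitonal_trans unfolding is_star_def by blast
  moreover have "s' \<prec> t'"
    using assms same_pitch_lower unfolding is_star_def by blast
  moreover have "\<not> y \<prec> t'" if "y \<simeq> s'" "s' \<prec> y" for y
  proof
    assume "y \<prec> t'"
    then have "y \<prec> t" "s \<prec> y"
      using same_pitch_lower same_pitch_refl sym that(2) by blast+
    then show False
      using assms(1) eq[OF that(1)] unfolding is_star_def by blast
  qed
  ultimately show ?thesis
    unfolding is_star_def by blast
qed

lemma is_star_iff_measure: "is_star s t \<longleftrightarrow> m (interval s t) = octave_measure m"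
proof
  assume "is_star s t"
  then show "m (interval s t) = octave_measure m"
    using octave_measure_eq octave_interval_def by blast
next
  assume meas: "m (interval s t) = octave_measure m"
  obtain u v where uv: "octave_interval (interval u v)"
    using octave_exists octave_interval_def by auto
  then have "interval s t \<cong> interval u v"
    using meas octave_measure_eq measure_cong by metis
  then have "octave_interval (interval s t)"
    using octave_cong uv interval_in_intervals by blast
  then obtain s' t' where "is_star s' t'" "interval s' t' = interval s t"
    unfolding octave_interval_def by metis
  then show "is_star s t"
    using is_star_same_pitch interval_eqD by blast
qed

lemma measure_octave_exists: "\<exists>t. m (interval s t) = octave_measure m"
  using octave_exists octave_interval_def octave_measure_eq measure_transport by metis

lemma measure_power_exists: "\<exists>t. m (interval s t) = octave_measure m ^ n"
proof (induction n)
  case 0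
  then show ?case
    using measure_eq_1 same_pitch_refl by auto
next
  case (Suc n)
  then obtain w where "m (interval s w) = octave_measure m ^ n" by blast
  moreover obtain t where "m (interval w t) = octave_measure m"
    using measure_octave_exists by blast
  ultimately show ?case
    using measure_mult[of s t w] by (auto simp: mult.commute)
qed

lemma measure_powi_exists: "\<exists>t. m (interval s t) = octave_measure m powi n"
proof (cases "n \<ge> 0")
  case True
  then show ?thesis
    using measure_power_exists by (simp add: power_int_def)
next
  case False
  obtain t where "m (interval s t) = octave_measure m ^ nat (- n)"
    using measure_power_exists by blast
  then have "m (interval t s) = octave_measure m powi n"
    using False measure_inverse[of t s] by (simp add: power_int_def power_inverse)
  then show ?thesis
    using measure_transport by metis
qed

lemma equitonal_if_measure_power:
  "m (interval s t) = octave_measure m ^ n \<Longrightarrow> s \<simeq> t"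
proof (induction n arbitrary: s)
  case 0
  then show ?case
    using measure_eq_1 same_pitch_equitonal by simp
next
  case (Suc n)
  obtain w where w: "m (interval s w) = octave_measure m"
    using measure_octave_exists by blast
  then have "m (interval w t) = octave_measure m ^ n"
    using Suc.prems measure_mult[of s t w] octave_measure_gt_1 by simp
  then have "w \<simeq> t"
    by (rule Suc.IH)
  moreover have "w \<simeq> s"
    using w is_star_iff_measure unfolding is_star_def by blast
  ultimately show ?case
    using equitonal_sym equitonal_trans by blast
qed

lemma equitonal_if_measure_powi:
  assumes "m (interval s t) = octave_measure m powi n"
  shows "s \<simeq> t"
proof (cases "n \<ge> 0")
  case True
  then show ?thesis
    using assms equitonal_if_measure_power by (simp add: power_int_def)
next
  case False
  then have "m (interval t s) = octave_measure m ^ nat (- n)"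
    using assms measure_inverse[of t s] by (simp add: power_int_def power_inverse)
  then show ?thesis
    using equitonal_if_measure_power equitonal_sym by blast
qed

text \<open>
  The minimality of \<open>w\<^sup>*\<close> in metric form: less than an octave above \<open>w\<close>, only sounds of the pitch
  of \<open>w\<close> are equitonal to it.
\<close>

lemma equitonal_within_octave:
  assumes "w \<simeq> t" "1 \<le> m (interval w t)" "m (interval w t) < octave_measure m"
  shows "m (interval w t) = 1"
proof (rule ccontr)
  assume "m (interval w t) \<noteq> 1"
  then have "w \<prec> t"
    using assms(2) measure_gt_1 by force
  obtain v where v: "m (interval w v) = octave_measure m"
    using measure_octave_exists by blast
  have "m (interval t v) > 1"
  proof (rule ccontr)
    assume "\<not> m (interval t v) > 1"
    then have "m (interval w t) * m (interval t v) \<le> m (interval w t)"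
      using assms(2) by (simp add: mult_left_le)
    then show False
      using assms(3) v measure_mult[of w v t] by simp
  qed
  then have "t \<prec> v"
    using measure_gt_1 by blast
  then show False
    using v \<open>w \<prec> t\<close> equitonal_sym[OF assms(1)] is_star_iff_measure
    unfolding is_star_def by blast
qed

lemma measure_powi_if_equitonal:
  assumes "s \<simeq> t"
  shows "\<exists>n::int. m (interval s t) = octave_measure m powi n"
proof -
  let ?k = "octave_measure m"
  obtain n :: int where n: "?k powi n \<le> m (interval s t)" "m (interval s t) < ?k * ?k powi n"
    using powi_bracket[OF octave_measure_gt_1 measure_pos[OF interval_in_intervals]] by blast
  obtain w where w: "m (interval s w) = ?k powi n"
    using measure_powi_exists by blast
  have pos: "?k powi n > 0"
    using octave_measure_gt_1 by simp
  have split: "m (interval s t) = ?k powi n * m (interval w t)"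
    using measure_mult[of s t w] w by simp
  have "w \<simeq> t"
    using equitonal_if_measure_powi[OF w] assms equitonal_sym equitonal_trans by blast
  moreover have "1 \<le> m (interval w t)" "m (interval w t) < ?k"
    using n pos unfolding split by (simp_all add: mult.commute)
  ultimately have "m (interval w t) = 1"
    by (rule equitonal_within_octave)
  then show ?thesis
    using split by auto
qed

end

theorem theorem5p27:
  fixes lower equitonal :: "'a \<Rightarrow> 'a \<Rightarrow> bool"
    and cong :: "'a set \<times> 'a set \<Rightarrow> 'a set \<times> 'a set \<Rightarrow> bool"
    and m :: "'a set \<times> 'a set \<Rightarrow> real"
    and x\<^sub>0 y\<^sub>0 s t :: 'a and lam k :: real
  assumes "tonality lower cong x\<^sub>0 y\<^sub>0 lam m equitonal"
    and "k = equitonal.octave_measure lower equitonal m"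
  shows "equitonal s t \<longleftrightarrow> (\<exists>n::int. m (pitch.interval lower s t) = k powi n)"
proof -
  interpret tonality lower cong x\<^sub>0 y\<^sub>0 lam m equitonal
    by (rule assms(1))
  show ?thesis
    unfolding assms(2)
    using measure_powi_if_equitonal equitonal_if_measure_powi by blast
qed

end
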